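(* For every integer $n\geq 2$, the conjugacy relation on $\mathrm{Aut}(\Lambda_n)$ is Borel complete.
   Context: A digraph is a set with an irreflexive antisymmetric binary relation $\to$. $I_n$ denotes the edgeless digraph on $n$ vertices; a digraph is $I_n$-free if it contains no independent set of size $n$. $\Lambda_n$ is the generic countable $I_n$-free digraph: the unique countable homogeneous digraph whose finite induced subdigraphs are exactly the finite $I_n$-free digraphs ($\Lambda_2$ is the random tournament). The conjugacy relation on $\mathrm{Aut}(\Lambda_n)$ identifies $\phi,\psi$ iff $\psi=\delta\phi\delta^{-1}$ for some $\delta\in\mathrm{Aut}(\Lambda_n)$. An equivalence relation $E$ is Borel complete if for every countable relational language and every Borel class of countable structures on $\mathbb{N}$, isomorphism on that class is Borel reducible to $E$ (via a Borel $f$ with $x\mathrel{E'}x'\iff f(x)\mathrel{E}f(x')$). *)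

theory Defs
  imports "HOL-Analysis.Analysis"
begin

definition digraph :: "'a set \<Rightarrow> 'a rel \<Rightarrow> bool" where
  "digraph V r \<longleftrightarrow> r \<subseteq> V \<times> V \<and> irrefl_on V r \<and> antisym_on V r"

definition independent_set :: "'a rel \<Rightarrow> 'a set \<Rightarrow> bool" where
  "independent_set r A \<longleftrightarrow> (\<forall>x\<in>A. \<forall>y\<in>A. (x, y) \<notin> r)"

definition I_free :: "nat \<Rightarrow> 'a set \<Rightarrow> 'a rel \<Rightarrow> bool" where
  "I_free n V r \<longleftrightarrow> \<not> (\<exists>A\<subseteq>V. finite A \<and> card A = n \<and> independent_set r A)"

definition digraph_iso :: "('a \<Rightarrow> 'b) \<Rightarrow> 'a set \<Rightarrow> 'a rel \<Rightarrow> 'b set \<Rightarrow> 'b rel \<Rightarrow> bool" where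
  "digraph_iso f V r W s \<longleftrightarrow>
     bij_betw f V W \<and> (\<forall>x\<in>V. \<forall>y\<in>V. (x, y) \<in> r \<longleftrightarrow> (f x, f y) \<in> s)"

definition digraph_aut :: "'a rel \<Rightarrow> ('a \<Rightarrow> 'a) set" where
  "digraph_aut r = {g. digraph_iso g UNIV r UNIV r}"

definition homogeneous_digraph :: "'a rel \<Rightarrow> bool" where
  "homogeneous_digraph r \<longleftrightarrow>
     (\<forall>A B f. finite A \<and> digraph_iso f A (Restr r A) B (Restr r B) \<longrightarrow>
        (\<exists>g\<in>digraph_aut r. \<forall>x\<in>A. g x = f x))"

(* r is a copy, on the vertex set of all natural numbers, of the generic countable digraph without
   independent sets of size n.  The last clause says that, up to isomorphism, the finite induced
   subdigraphs are exactly the finite digraphs without such sets; every finite digraph has a copy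
   with vertices in nat.  For n > 1 all finite tournaments occur among them, so the generic
   digraph is infinite and does have copies on nat. *)
definition generic_I_free :: "nat \<Rightarrow> nat rel \<Rightarrow> bool" where
  "generic_I_free n r \<longleftrightarrow>
     digraph UNIV r \<and> homogeneous_digraph r \<and>
     (\<forall>(A :: nat set) s. finite A \<and> digraph A s \<longrightarrow>
        (I_free n A s \<longleftrightarrow> (\<exists>B f. digraph_iso f A s B (Restr r B))))"

definition conjugacy :: "('a \<Rightarrow> 'a) set \<Rightarrow> ('a \<Rightarrow> 'a) rel" where
  "conjugacy G = {(\<phi>, \<psi>). \<phi> \<in> G \<and> \<psi> \<in> G \<and> (\<exists>\<delta>\<in>G. \<psi> = \<delta> \<circ> \<phi> \<circ> inv \<delta>)}"

(* A countable relational language is given by its set S of symbols, coded as natural numbers, and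
   their arities ar.  A structure M on nat sends a symbol i to the set of tuples xs satisfying it;
   values of M at non-symbols and at lists of the wrong length are normalised to False.  This makes
   the set of structures a closed subspace of the product space of functions into the discrete
   space bool, homeomorphic to the product over i in S of the powersets of the sets of
   (ar i)-tuples. *)
definition structures :: "nat set \<Rightarrow> (nat \<Rightarrow> nat) \<Rightarrow> (nat \<Rightarrow> nat list \<Rightarrow> bool) set" where
  "structures S ar = {M. \<forall>i xs. M i xs \<longrightarrow> i \<in> S \<and> length xs = ar i}"

definition isomorphism_on ::
  "nat set \<Rightarrow> (nat \<Rightarrow> nat) \<Rightarrow> (nat \<Rightarrow> nat list \<Rightarrow> bool) set \<Rightarrow> (nat \<Rightarrow> nat list \<Rightarrow> bool) rel" where
  "isomorphism_on S ar K =
     {(M, N). M \<in> K \<and> N \<in> K \<and>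
        (\<exists>\<pi>. bij \<pi> \<and> (\<forall>i\<in>S. \<forall>xs. length xs = ar i \<longrightarrow> (M i xs \<longleftrightarrow> N i (map \<pi> xs))))}"

(* X and Y carry the Borel structures of their subspace topologies. *)
definition borel_reducible ::
  "'a::topological_space set \<Rightarrow> 'a rel \<Rightarrow> 'b::topological_space set \<Rightarrow> 'b rel \<Rightarrow> bool" where
  "borel_reducible X E Y F \<longleftrightarrow>
     (\<exists>f \<in> restrict_space borel X \<rightarrow>\<^sub>M restrict_space borel Y.
        \<forall>x\<in>X. \<forall>x'\<in>X. (x, x') \<in> E \<longleftrightarrow> (f x, f x') \<in> F)"

(* K is not required to be closed under isomorphism.  Dropping that requirement does not change
   the notion, since a reduction defined on all structures restricts to every subset. *)
definition borel_complete :: "'a::topological_space set \<Rightarrow> 'a rel \<Rightarrow> bool" where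
  "borel_complete Y E \<longleftrightarrow>
     equiv Y E \<and>
     (\<forall>S ar K. K \<subseteq> structures S ar \<and> K \<in> sets borel \<longrightarrow>
        borel_reducible K (isomorphism_on S ar K) Y E)"

end

theory Submission
  imports Defs
begin

text \<open>Let \<open>\<Lambda>\<close> be the generic digraph.  It is characterised by a one-point extension property, so it
  can be built freely over any countable tournament \<open>B\<close>: repeatedly adjoin vertices that realise
  the admissible types over finite sets, infinitely many copies for each type, indexed by integers,
  and orient the remaining pairs by an invariant tournament.  This is functorial in \<open>B\<close>, and an
  automorphism of \<open>B\<close> can be lifted so that the indices of all new vertices are shifted.

  An action of the symmetric group on a tournament would have to be trivial on involutions, so color
  the rationals by natural numbers with all color classes dense: each permutation of the colors
  lifts to an automorphism of the ordered rationals.  A structure on the natural numbers is then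
  determined up to isomorphism by the tree of finite sequences of rationals, where a sequence carries
  one bit, an atomic fact about its tuple of colors.  This tree is a fixed tournament \<open>B\<close>, with a
  copy of the integers over each node, and the bits are coded by the direction in which an
  automorphism of \<open>B\<close> translates these copies.  The digraph therefore does not depend on the
  structure, only the automorphism does, and each of its values depends on finitely many bits.

  For decoding, consider for a vertex \<open>x\<close> the exponents \<open>j > 0\<close> with an edge from the \<open>j\<close>-th iterate
  of \<open>x\<close> to \<open>x\<close>.  This set is empty for new vertices and determines the length and the bit of the
  node for vertices of \<open>B\<close>, so a conjugation restricts to an isomorphism of labelled trees, which
  gives an isomorphism of structures by back and forth.\<close>

section \<open>Back and forth, and a generic coloring of the rationals\<close>

text \<open>An increasing chain of members of \<open>P\<close> exhausts both enumerations, and its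
  union is the graph of \<open>h\<close>. The second part of the conclusion puts each finite piece
  of \<open>h\<close> inside one member of \<open>P\<close>, so that relations between finitely many
  points carry over to \<open>h\<close>.\<close>

lemma back_and_forth:
  fixes A :: "'a set" and B :: "'b set" and P :: "('a \<times> 'b) set \<Rightarrow> bool"
  assumes "countable A" "countable B" "A \<noteq> {}" "B \<noteq> {}" and empty: "P {}"
    and forth: "\<And>p a. P p \<Longrightarrow> a \<in> A \<Longrightarrow> \<exists>b. P (insert (a, b) p)"
    and backw: "\<And>p b. P p \<Longrightarrow> b \<in> B \<Longrightarrow> \<exists>a. P (insert (a, b) p)"
    and sub: "\<And>p. P p \<Longrightarrow> p \<subseteq> A \<times> B"
    and inj: "\<And>p x y x' y'. P p \<Longrightarrow> (x, y) \<in> p \<Longrightarrow> (x', y') \<in> p \<Longrightarrow> x = x' \<longleftrightarrow> y = y'"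
  shows "\<exists>h. bij_betw h A B \<and> (\<forall>F\<subseteq>A. finite F \<longrightarrow> (\<exists>p. P p \<and> (\<forall>a\<in>F. (a, h a) \<in> p)))"
proof -
  let ?a = "from_nat_into A" and ?b = "from_nat_into B"
  have step: "\<exists>q. P q \<and> p \<subseteq> q \<and> ?a k \<in> Domain q \<and> ?b k \<in> Range q" if "P p" for p k
  proof -
    obtain b where b: "P (insert (?a k, b) p)"
      using forth[OF \<open>P p\<close> from_nat_into[OF \<open>A \<noteq> {}\<close>]] by blast
    obtain a where "P (insert (a, ?b k) (insert (?a k, b) p))"
      using backw[OF b from_nat_into[OF \<open>B \<noteq> {}\<close>]] by blast
    then show ?thesis by blast
  qed
  obtain p where p: "\<And>k. P (p k)"
    "\<And>k. p k \<subseteq> p (Suc k) \<and> ?a k \<in> Domain (p (Suc k)) \<and> ?b k \<in> Range (p (Suc k))"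
    using dependent_nat_choice[of "\<lambda>k. P"
        "\<lambda>k p q. p \<subseteq> q \<and> ?a k \<in> Domain q \<and> ?b k \<in> Range q"] empty step by metis
  have mono: "p k \<subseteq> p l" if "k \<le> l" for k l
    using p(2) that by (simp add: lift_Suc_mono_le)
  have single: "x = x' \<longleftrightarrow> y = y'" if "(x, y) \<in> p k" "(x', y') \<in> p l" for x y x' y' k l
    using inj[OF p(1)[of "max k l"], of x y x' y'] mono[of k "max k l"] mono[of l "max k l"] that
    by auto
  define h where "h a = (SOME b. \<exists>k. (a, b) \<in> p k)" for a
  have hex: "\<exists>k. (a, h a) \<in> p k" if "a \<in> A" for a
  proof -
    obtain k where "?a k = a"
      using from_nat_into_surj[OF \<open>countable A\<close> \<open>a \<in> A\<close>] by blast
    then have "\<exists>b k. (a, b) \<in> p k" using p(2)[of k] by blast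
    then show ?thesis unfolding h_def by (rule someI_ex)
  qed
  have "bij_betw h A B"
  proof (rule bij_betwI')
    show "h x = h y \<longleftrightarrow> x = y" if "x \<in> A" "y \<in> A" for x y
      using hex[OF that(1)] hex[OF that(2)] single by blast
    show "h x \<in> B" if "x \<in> A" for x using hex[OF that] sub[OF p(1)] by blast
    show "\<exists>x\<in>A. y = h x" if "y \<in> B" for y
    proof -
      obtain k where "?b k = y"
        using from_nat_into_surj[OF \<open>countable B\<close> \<open>y \<in> B\<close>] by blast
      then obtain x where x: "(x, y) \<in> p (Suc k)" using p(2)[of k] by blast
      then have "x \<in> A" using sub[OF p(1)] by blast
      then show ?thesis using hex x single by blast
    qed
  qed
  moreover have "\<exists>k. \<forall>a\<in>F. (a, h a) \<in> p k" if "finite F" "F \<subseteq> A" for F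
    using that
  proof (induction F rule: finite_induct)
    case (insert a F)
    then obtain k l where "\<forall>a\<in>F. (a, h a) \<in> p k" "(a, h a) \<in> p l" using hex by force
    then have "\<forall>a\<in>insert a F. (a, h a) \<in> p (max k l)"
      using mono[of k "max k l"] mono[of l "max k l"] by auto
    then show ?case by blast
  qed simp
  ultimately show ?thesis using p(1) by (intro exI[of _ h]) blast
qed

section \<open>A coloring of the rationals with dense color classes\<close>

lemma inj_choice:
  fixes X :: "nat \<Rightarrow> 'a set"
  assumes "\<And>k. infinite (X k)"
  obtains f where "inj f" "\<And>k. f k \<in> X k"
proof -
  have "\<exists>f. \<forall>k. f k \<in> X k - f ` {..<k}"
  proof (rule dependent_wellorder_choice)
    show "\<exists>x. x \<in> X k - f ` {..<k}" for k and f :: "nat \<Rightarrow> 'a"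
      using assms[of k] Diff_infinite_finite[of "f ` {..<k}" "X k"]
      by (metis finite.emptyI ex_in_conv finite_imageI finite_lessThan)
  next
    show "(r \<in> X k - f ` {..<k}) = (r \<in> X k - g ` {..<k})" if "\<And>j. j < k \<Longrightarrow> f j = g j"
      for r f g k using that by (metis image_cong lessThan_iff)
  qed
  then obtain f where f: "\<And>k. f k \<in> X k - f ` {..<k}" by blast
  have "inj f"
    by (rule linorder_injI) (metis Diff_iff f imageI lessThan_iff)
  then show thesis using that f by blast
qed

text \<open>List all triples \<open>(x, y, k)\<close> and pick distinct rationals, one from each
  interval; a picked rational gets the third entry of its triple as its color.\<close>

lemma dense_coloring_ex:
  "\<exists>c :: rat \<Rightarrow> nat. \<forall>x y k. x < y \<longrightarrow> (\<exists>q. x < q \<and> q < y \<and> c q = k)"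
proof -
  let ?I = "\<lambda>m. from_nat m :: rat \<times> rat \<times> nat"
  \<comment> \<open>The default \<open>UNIV\<close> for an empty interval keeps every set infinite,
    so that \<open>inj_choice\<close> applies.\<close>
  define X where
    "X m = (case ?I m of (x, y, k) \<Rightarrow> if x < y then {x<..<y} else UNIV)" for m
  have "infinite (X m)" for m
    unfolding X_def by (simp add: infinite_Ioo infinite_UNIV_char_0 split: prod.split)
  then obtain f where f: "inj f" "\<And>m. f m \<in> X m" using inj_choice[of X] by blast
  have "\<exists>q. x < q \<and> q < y \<and> snd (snd (?I (inv f q))) = k" if "x < y" for x y k
    using f(2)[of "to_nat (x, y, k)"] that inv_f_f[OF f(1), of "to_nat (x, y, k)"]
    by (intro exI[of _ "f (to_nat (x, y, k))"]) (simp add: X_def)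
  then show ?thesis by (intro exI[of _ "\<lambda>q. snd (snd (?I (inv f q)))"]) blast
qed

definition color :: "rat \<Rightarrow> nat" where
  "color = (SOME c. \<forall>x y k. x < y \<longrightarrow> (\<exists>q. x < q \<and> q < y \<and> c q = k))"

lemma color_dense: "x < y \<Longrightarrow> \<exists>q. x < q \<and> q < y \<and> color q = k"
  using someI_ex[OF dense_coloring_ex] unfolding color_def by blast

lemma color_surj: "\<exists>q. color q = k"
  using color_dense[of 0 1] by auto

lemma color_between:
  assumes "finite L" "finite U" "\<And>x y. x \<in> L \<Longrightarrow> y \<in> U \<Longrightarrow> x < y"
  shows "\<exists>q. color q = k \<and> (\<forall>x\<in>L. x < q) \<and> (\<forall>y\<in>U. q < y)"
proof -
  \<comment> \<open>A missing side is replaced by a bound at distance 1 from the other one, which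
    gives \<open>l < u\<close> in all cases.\<close>
  define l where "l = (if L = {} then (if U = {} then 0 else Min U - 1) else Max L)"
  define u where "u = (if U = {} then l + 1 else Min U)"
  have "l < u"
    using assms by (simp add: l_def u_def del: Max_less_iff Min_gr_iff)
  then obtain q where q: "l < q" "q < u" "color q = k" using color_dense by blast
  have "x < q" if "x \<in> L" for x
    using that q(1) Max_ge[OF assms(1) that] by (auto simp: l_def split: if_splits)
  moreover have "q < y" if "y \<in> U" for y
    using that q(2) Min_le[OF assms(2) that] by (auto simp: u_def split: if_splits)
  ultimately show ?thesis using q(3) by blast
qed

text \<open>A new point goes into the gap between the images of the smaller and of the larger
  points, where every color is available. Applied to the converse of \<open>p\<close> and to
  \<open>inv \<pi>\<close>, the same step serves the other direction.\<close>

lemma color_forth: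
  assumes "finite p" and cmp: "\<And>x y x' y'. (x, y) \<in> p \<Longrightarrow> (x', y') \<in> p \<Longrightarrow> x < x' \<longleftrightarrow> y < y'"
    and col: "\<And>x y. (x, y) \<in> p \<Longrightarrow> color y = \<pi> (color x)"
  shows "\<exists>b. (\<forall>(x, y)\<in>p. (x < a \<longleftrightarrow> y < b) \<and> (a < x \<longleftrightarrow> b < y)) \<and> color b = \<pi> (color a)"
proof (cases "a \<in> Domain p")
  case True
  then obtain b where "(a, b) \<in> p" by blast
  then show ?thesis using cmp col by (intro exI[of _ b]) blast
next
  case False
  let ?L = "snd ` {z\<in>p. fst z < a}" and ?U = "snd ` {z\<in>p. a < fst z}"
  have "\<exists>q. color q = \<pi> (color a) \<and> (\<forall>x\<in>?L. x < q) \<and> (\<forall>y\<in>?U. q < y)"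
    using assms(1) cmp by (intro color_between) (auto, force)
  then obtain q where q: "color q = \<pi> (color a)" "\<forall>x\<in>?L. x < q" "\<forall>y\<in>?U. q < y" by blast
  have "(x < a \<longleftrightarrow> y < q) \<and> (a < x \<longleftrightarrow> q < y)" if "(x, y) \<in> p" for x y
  proof -
    have "x \<noteq> a" using False that by blast
    moreover have "y < q" if "x < a" using that \<open>(x, y) \<in> p\<close> q(2) by force
    moreover have "q < y" if "a < x" using that \<open>(x, y) \<in> p\<close> q(3) by force
    ultimately show ?thesis by (metis linorder_neqE less_asym)
  qed
  then show ?thesis using q(1) by blast
qed

lemma color_lift:
  assumes "bij \<pi>"
  obtains \<alpha> :: "rat \<Rightarrow> rat" where "bij \<alpha>" "\<And>x y. x < y \<longleftrightarrow> \<alpha> x < \<alpha> y"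
    "\<And>x. color (\<alpha> x) = \<pi> (color x)"
proof -
  define P :: "(rat \<times> rat) set \<Rightarrow> bool" where
    "P p \<longleftrightarrow> finite p \<and> (\<forall>(x, y)\<in>p. color y = \<pi> (color x) \<and> (\<forall>(x', y')\<in>p. x < x' \<longleftrightarrow> y < y'))"
    for p
  have fin: "finite p" if "P p" for p using that by (simp add: P_def)
  have cmp: "x < x' \<longleftrightarrow> y < y'" if "P p" "(x, y) \<in> p" "(x', y') \<in> p" for p x y x' y'
    using that by (auto simp: P_def)
  have col: "color y = \<pi> (color x)" if "P p" "(x, y) \<in> p" for p x y
    using that by (auto simp: P_def)
  have "\<exists>\<alpha>. bij_betw \<alpha> UNIV UNIV \<and>
    (\<forall>F\<subseteq>UNIV. finite F \<longrightarrow> (\<exists>p. P p \<and> (\<forall>a\<in>F. (a, \<alpha> a) \<in> p)))"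
  proof (rule back_and_forth[of UNIV UNIV P])
    show "P {}" by (simp add: P_def)
    show "\<exists>b. P (insert (a, b) p)" if p: "P p" for p a
    proof -
      have "\<exists>b. (\<forall>(x, y)\<in>p. (x < a \<longleftrightarrow> y < b) \<and> (a < x \<longleftrightarrow> b < y)) \<and> color b = \<pi> (color a)"
        by (rule color_forth) (use fin[OF p] cmp[OF p] col[OF p] in auto)
      then obtain b where "\<forall>(x, y)\<in>p. (x < a \<longleftrightarrow> y < b) \<and> (a < x \<longleftrightarrow> b < y)"
        "color b = \<pi> (color a)" by blast
      then show ?thesis using p by (intro exI[of _ b]) (auto simp: P_def)
    qed
    show "\<exists>a. P (insert (a, b) p)" if p: "P p" for p b
    proof -
      have "\<exists>a. (\<forall>(y, x)\<in>p\<inverse>. (y < b \<longleftrightarrow> x < a) \<and> (b < y \<longleftrightarrow> a < x)) \<and> color a = inv \<pi> (color b)"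
        by (rule color_forth)
          (use fin[OF p] cmp[OF p] col[OF p] in \<open>auto simp: inv_f_f[OF bij_is_inj[OF assms]]\<close>)
      then obtain a where "\<forall>(y, x)\<in>p\<inverse>. (y < b \<longleftrightarrow> x < a) \<and> (b < y \<longleftrightarrow> a < x)"
        "color a = inv \<pi> (color b)" by blast
      moreover from this have "color b = \<pi> (color a)"
        by (simp add: surj_f_inv_f[OF bij_is_surj[OF assms]])
      ultimately show ?thesis using p by (intro exI[of _ a]) (auto simp: P_def)
    qed
    show "x = x' \<longleftrightarrow> y = y'" if "P p" "(x, y) \<in> p" "(x', y') \<in> p" for p x y x' y'
      using cmp[OF that] cmp[OF that(1,3,2)] by (metis less_irrefl linorder_neqE)
  qed auto
  then obtain \<alpha> where \<alpha>: "bij \<alpha>" "\<And>F. finite F \<Longrightarrow> \<exists>p. P p \<and> (\<forall>a\<in>F. (a, \<alpha> a) \<in> p)"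
    by auto
  show thesis
  proof (rule that)
    show "x < y \<longleftrightarrow> \<alpha> x < \<alpha> y" for x y using \<alpha>(2)[of "{x, y}"] cmp by fastforce
    show "color (\<alpha> x) = \<pi> (color x)" for x using \<alpha>(2)[of "{x}"] col by fastforce
  qed (rule \<alpha>(1))
qed

section \<open>The extension property\<close>

text \<open>\<open>c\<close> prescribes the type of a new vertex, with 2 or more for no edge. The
  excluded types are those whose realization would complete an independent set of size
  \<open>n\<close>.\<close>

definition extension_property :: "nat \<Rightarrow> 'a set \<Rightarrow> 'a rel \<Rightarrow> bool" where
  "extension_property n V e \<longleftrightarrow>
     (\<forall>F c. finite F \<and> F \<subseteq> V \<and>
        \<not> (\<exists>A\<subseteq>{y\<in>F. c y \<ge> (2::nat)}. card A = n - 1 \<and> independent_set e A) \<longrightarrow>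
        (\<exists>x\<in>V - F. \<forall>y\<in>F. ((x, y) \<in> e \<longleftrightarrow> c y = 0) \<and> ((y, x) \<in> e \<longleftrightarrow> c y = 1)))"

definition oriented :: "'a rel \<Rightarrow> bool" where
  "oriented e \<longleftrightarrow> (\<forall>x y. (x, y) \<in> e \<longrightarrow> (y, x) \<notin> e)"

text \<open>The type of \<open>a\<close> over the domain of \<open>p\<close> is copied to the range.
  It is admissible: an independent set of size \<open>n - 1\<close> among the prescribed
  non-neighbors would pull back along \<open>p\<close> and, together with \<open>a\<close>,
  contradict \<open>I_free n V e\<close>.\<close>

lemma extension_forth:
  assumes n: "n \<ge> 1" and e: "oriented e" and Ie: "I_free n V e"
    and ext: "extension_property n W s"
    and p: "finite p" "p \<subseteq> V \<times> W"
    and inj: "\<And>x y x' y'. (x, y) \<in> p \<Longrightarrow> (x', y') \<in> p \<Longrightarrow> x = x' \<longleftrightarrow> y = y'"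
    and iso: "\<And>x y x' y'. (x, y) \<in> p \<Longrightarrow> (x', y') \<in> p \<Longrightarrow> (x, x') \<in> e \<longleftrightarrow> (y, y') \<in> s"
    and a: "a \<in> V"
  shows "\<exists>b\<in>W. \<forall>x y. (x, y) \<in> p \<longrightarrow> (x = a \<longleftrightarrow> y = b) \<and>
           ((x, a) \<in> e \<longleftrightarrow> (y, b) \<in> s) \<and> ((a, x) \<in> e \<longleftrightarrow> (b, y) \<in> s)"
proof (cases "a \<in> Domain p")
  case True
  then obtain b where "(a, b) \<in> p" by blast
  then show ?thesis using inj iso p(2) by (intro bexI[of _ b]) blast+
next
  case False
  define g where "g y = (THE x. (x, y) \<in> p)" for y
  have g: "g y = x" if "(x, y) \<in> p" for x y
    unfolding g_def using that inj by blast
  define c where "c y = (if (a, g y) \<in> e then 0 else if (g y, a) \<in> e then 1 else 2::nat)" for y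
  have no: "\<not> (card A = n - 1 \<and> independent_set s A)" if "A \<subseteq> {y\<in>Range p. c y \<ge> 2}" for A
  proof
    assume A: "card A = n - 1 \<and> independent_set s A"
    have gp: "(g y, y) \<in> p" if "y \<in> A" for y
      using that \<open>A \<subseteq> _\<close> g by blast
    have fA: "finite A" using \<open>A \<subseteq> _\<close> p(1) by (auto intro: finite_subset simp: finite_Range)
    have "inj_on g A" using inj[OF gp gp] by (auto intro: inj_onI)
    moreover have na: "a \<notin> g ` A" using gp False by blast
    ultimately have "card (insert a (g ` A)) = n"
      using A n fA by (simp add: card_image)
    moreover have "independent_set e (insert a (g ` A))"
      unfolding independent_set_def
    proof (intro ballI)
      fix x y assume xy: "x \<in> insert a (g ` A)" "y \<in> insert a (g ` A)"
      have "(a, a) \<notin> e" using e by (auto simp: oriented_def)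
      moreover have "(a, g y) \<notin> e" "(g y, a) \<notin> e" if "y \<in> A" for y
        using that \<open>A \<subseteq> _\<close> by (auto simp: c_def split: if_splits)
      moreover have "(g x, g y) \<notin> e" if "x \<in> A" "y \<in> A" for x y
        using iso[OF gp gp] that A by (auto simp: independent_set_def)
      ultimately show "(x, y) \<notin> e" using xy by blast
    qed
    moreover have "insert a (g ` A) \<subseteq> V" using gp p(2) a by blast
    ultimately show False using Ie fA unfolding I_free_def by blast
  qed
  obtain b where b: "b \<in> W - Range p"
    "\<forall>y\<in>Range p. ((b, y) \<in> s \<longleftrightarrow> c y = 0) \<and> ((y, b) \<in> s \<longleftrightarrow> c y = 1)"
    using ext[unfolded extension_property_def, rule_format, of "Range p" c] no p
    by (auto simp: finite_Range)
  have "(x = a \<longleftrightarrow> y = b) \<and> ((x, a) \<in> e \<longleftrightarrow> (y, b) \<in> s) \<and> ((a, x) \<in> e \<longleftrightarrow> (b, y) \<in> s)"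
    if "(x, y) \<in> p" for x y
  proof -
    have "y \<in> Range p" "x \<noteq> a" using that False by blast+
    moreover from this have "y \<noteq> b" using b(1) by blast
    ultimately show ?thesis
      using b(2) g[OF that] e by (auto simp: c_def oriented_def split: if_splits)
  qed
  then show ?thesis using b(1) by blast
qed

lemma extension_property_unique:
  assumes n: "n \<ge> 1"
    and V: "countable V" "V \<noteq> {}" "oriented e" "I_free n V e" "extension_property n V e"
    and W: "countable W" "W \<noteq> {}" "oriented s" "I_free n W s" "extension_property n W s"
  obtains h where "bij_betw h V W" "\<And>x y. x \<in> V \<Longrightarrow> y \<in> V \<Longrightarrow> (x, y) \<in> e \<longleftrightarrow> (h x, h y) \<in> s"
proof -
  define P where
    "P p \<longleftrightarrow> finite p \<and> p \<subseteq> V \<times> W \<and>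
       (\<forall>x y x' y'. (x, y) \<in> p \<longrightarrow> (x', y') \<in> p \<longrightarrow>
          (x = x' \<longleftrightarrow> y = y') \<and> ((x, x') \<in> e \<longleftrightarrow> (y, y') \<in> s))" for p
  have fin: "finite p" "p \<subseteq> V \<times> W" if "P p" for p using that by (auto simp: P_def)
  have inj: "x = x' \<longleftrightarrow> y = y'" and iso: "(x, x') \<in> e \<longleftrightarrow> (y, y') \<in> s"
    if "P p" "(x, y) \<in> p" "(x', y') \<in> p" for p x y x' y'
    using that unfolding P_def by blast+
  have irr: "(x, x) \<notin> e" "(y, y) \<notin> s" for x y using V(3) W(3) by (auto simp: oriented_def)
  have P_insert: "P (insert (a, b) p)"
    if p: "P p" and ab: "a \<in> V" "b \<in> W"
      and *: "\<And>x y. (x, y) \<in> p \<Longrightarrow> (x = a \<longleftrightarrow> y = b) \<and>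
           ((x, a) \<in> e \<longleftrightarrow> (y, b) \<in> s) \<and> ((a, x) \<in> e \<longleftrightarrow> (b, y) \<in> s)" for p a b
  proof -
    have "(x = x' \<longleftrightarrow> y = y') \<and> ((x, x') \<in> e \<longleftrightarrow> (y, y') \<in> s)"
      if "(x, y) \<in> insert (a, b) p" "(x', y') \<in> insert (a, b) p" for x y x' y'
    proof -
      consider "x = a" "y = b" "x' = a" "y' = b" | "x = a" "y = b" "(x', y') \<in> p"
        | "(x, y) \<in> p" "x' = a" "y' = b" | "(x, y) \<in> p" "(x', y') \<in> p"
        using \<open>(x, y) \<in> _\<close> \<open>(x', y') \<in> _\<close> by blast
      then show ?thesis
        by cases (use irr *[of x' y'] *[of x y] inj[OF p, of x y x' y'] iso[OF p, of x y x' y'] in blast)+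
    qed
    then have "\<forall>x y x' y'. (x, y) \<in> insert (a, b) p \<longrightarrow> (x', y') \<in> insert (a, b) p \<longrightarrow>
          (x = x' \<longleftrightarrow> y = y') \<and> ((x, x') \<in> e \<longleftrightarrow> (y, y') \<in> s)" by blast
    moreover have "finite (insert (a, b) p)" "insert (a, b) p \<subseteq> V \<times> W" using fin[OF p] ab by auto
    ultimately show ?thesis unfolding P_def by blast
  qed
  have "\<exists>h. bij_betw h V W \<and> (\<forall>F\<subseteq>V. finite F \<longrightarrow> (\<exists>p. P p \<and> (\<forall>a\<in>F. (a, h a) \<in> p)))"
  proof (rule back_and_forth[OF V(1) W(1) V(2) W(2), of P])
    show "P {}" by (simp add: P_def)
    show "\<exists>b. P (insert (a, b) p)" if p: "P p" and a: "a \<in> V" for p a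
    proof -
      have "\<exists>b\<in>W. \<forall>x y. (x, y) \<in> p \<longrightarrow> (x = a \<longleftrightarrow> y = b) \<and>
           ((x, a) \<in> e \<longleftrightarrow> (y, b) \<in> s) \<and> ((a, x) \<in> e \<longleftrightarrow> (b, y) \<in> s)"
        by (rule extension_forth[OF n V(3,4) W(5) fin[OF p] inj[OF p] iso[OF p] a])
      then obtain b where "b \<in> W" "\<forall>x y. (x, y) \<in> p \<longrightarrow> (x = a \<longleftrightarrow> y = b) \<and>
           ((x, a) \<in> e \<longleftrightarrow> (y, b) \<in> s) \<and> ((a, x) \<in> e \<longleftrightarrow> (b, y) \<in> s)" by (elim bexE)
      then have "P (insert (a, b) p)" by (intro P_insert[OF p a]) blast+
      then show ?thesis ..
    qed
    show "\<exists>a. P (insert (a, b) p)" if p: "P p" and b: "b \<in> W" for p b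
    proof -
      have "\<exists>a\<in>V. \<forall>y x. (y, x) \<in> p\<inverse> \<longrightarrow> (y = b \<longleftrightarrow> x = a) \<and>
           ((y, b) \<in> s \<longleftrightarrow> (x, a) \<in> e) \<and> ((b, y) \<in> s \<longleftrightarrow> (a, x) \<in> e)"
      proof (rule extension_forth[OF n W(3,4) V(5)])
        show "finite (p\<inverse>)" "p\<inverse> \<subseteq> W \<times> V" using fin[OF p] by auto
        show "x = x' \<longleftrightarrow> y = y'" "(x, x') \<in> s \<longleftrightarrow> (y, y') \<in> e"
          if "(x, y) \<in> p\<inverse>" "(x', y') \<in> p\<inverse>" for x y x' y'
          using inj[OF p, of y x y' x'] iso[OF p, of y x y' x'] that unfolding converse_iff by simp_all
      qed (rule b)
      then obtain a where "a \<in> V" "\<forall>y x. (y, x) \<in> p\<inverse> \<longrightarrow> (y = b \<longleftrightarrow> x = a) \<and>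
           ((y, b) \<in> s \<longleftrightarrow> (x, a) \<in> e) \<and> ((b, y) \<in> s \<longleftrightarrow> (a, x) \<in> e)" by (elim bexE)
      then have "P (insert (a, b) p)" by (intro P_insert[OF p _ b]) blast+
      then show ?thesis ..
    qed
  next
    show "p \<subseteq> V \<times> W" if "P p" for p using that by (rule fin)
    show "x = x' \<longleftrightarrow> y = y'" if "P p" "(x, y) \<in> p" "(x', y') \<in> p" for p x y x' y'
      using that by (rule inj)
  qed
  then obtain h where h: "bij_betw h V W"
    and F: "\<And>F. finite F \<Longrightarrow> F \<subseteq> V \<Longrightarrow> \<exists>p. P p \<and> (\<forall>a\<in>F. (a, h a) \<in> p)"
    by blast
  have "(x, y) \<in> e \<longleftrightarrow> (h x, h y) \<in> s" if "x \<in> V" "y \<in> V" for x y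
  proof -
    obtain p where "P p" "\<forall>a\<in>{x, y}. (a, h a) \<in> p"
      using F[of "{x, y}"] \<open>x \<in> V\<close> \<open>y \<in> V\<close> by blast
    then show ?thesis using iso[of p x "h x" y "h y"] by simp
  qed
  then show thesis using that h by blast
qed

section \<open>The generic digraph has the extension property\<close>

lemma digraph_oriented: "digraph UNIV r \<Longrightarrow> oriented r"
  by (auto simp: digraph_def oriented_def irrefl_on_def antisym_on_def)

lemma generic_I_free_I_free:
  assumes "generic_I_free n r"
  shows "I_free n UNIV r"
proof -
  have "\<not> (finite A \<and> card A = n \<and> independent_set r A)" for A
  proof
    assume A: "finite A \<and> card A = n \<and> independent_set r A"
    have "digraph A (Restr r A)"
      using assms by (auto simp: generic_I_free_def digraph_def irrefl_on_def antisym_on_def)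
    moreover have "digraph_iso id A (Restr r A) A (Restr r A)"
      by (simp add: digraph_iso_def)
    ultimately have "I_free n A (Restr r A)"
      using assms A unfolding generic_I_free_def by blast
    then show False using A by (auto simp: I_free_def independent_set_def)
  qed
  then show ?thesis by (auto simp: I_free_def)
qed

text \<open>Adjoin an abstract vertex of the required type to \<open>F\<close>. The result has a
  copy inside \<open>r\<close>, possibly far from \<open>F\<close>; homogeneity yields an
  automorphism \<open>g\<close> that carries \<open>F\<close> onto its copy, and the preimage under
  \<open>g\<close> of the copied vertex is as required.\<close>

lemma generic_I_free_extension:
  assumes gen: "generic_I_free n r" and n: "n \<ge> 2"
  shows "extension_property n UNIV r"
  unfolding extension_property_def
proof (intro allI impI, elim conjE)
  fix F :: "nat set" and c :: "nat \<Rightarrow> nat"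
  assume F: "finite F"
    and c: "\<not> (\<exists>A\<subseteq>{y\<in>F. c y \<ge> 2}. card A = n - 1 \<and> independent_set r A)"
  have ori: "oriented r" using gen digraph_oriented by (auto simp: generic_I_free_def)
  \<comment> \<open>Finite digraphs are tested with vertices in \<open>nat\<close>, so a fresh
    number stands for the new vertex.\<close>
  obtain z where z: "z \<notin> F" using ex_new_if_finite[OF infinite_UNIV_nat F] by blast
  define s where "s = Restr r F \<union> {z} \<times> {y\<in>F. c y = 0} \<union> {y\<in>F. c y = 1} \<times> {z}"
  have sF: "(x, y) \<in> s \<longleftrightarrow> (x, y) \<in> r" if "x \<in> F" "y \<in> F" for x y
    using that z by (auto simp: s_def)
  have "digraph (insert z F) s"
    using ori z by (auto simp: digraph_def irrefl_on_def antisym_on_def s_def oriented_def)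
  moreover have "I_free n (insert z F) s"
    unfolding I_free_def
  proof (intro notI, elim exE conjE)
    fix A assume A: "A \<subseteq> insert z F" "finite A" "card A = n" "independent_set s A"
    show False
    proof (cases "z \<in> A")
      case True
      have "A - {z} \<subseteq> {y\<in>F. c y \<ge> 2}"
      proof
        fix y assume y: "y \<in> A - {z}"
        then have "(z, y) \<notin> s" "(y, z) \<notin> s" "y \<in> F"
          using A(1,4) True by (auto simp: independent_set_def)
        then have "c y \<noteq> 0" "c y \<noteq> 1" by (auto simp: s_def)
        then show "y \<in> {y\<in>F. c y \<ge> 2}" using \<open>y \<in> F\<close> by auto
      qed
      moreover have "card (A - {z}) = n - 1" using True A(2,3) by simp
      moreover have "independent_set r (A - {z})"
        using A(1,4) sF unfolding independent_set_def by blast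
      ultimately show False using c by blast
    next
      case False
      then have "independent_set r A" using A(1,4) sF unfolding independent_set_def by blast
      then show False using generic_I_free_I_free[OF gen] A(2,3) by (auto simp: I_free_def)
    qed
  qed
  ultimately obtain B f where f: "digraph_iso f (insert z F) s B (Restr r B)"
    using gen F unfolding generic_I_free_def by (metis finite.insertI)
  then have bij: "bij_betw f (insert z F) B"
    and fe: "\<And>x y. x \<in> insert z F \<Longrightarrow> y \<in> insert z F \<Longrightarrow> (x, y) \<in> s \<longleftrightarrow> (f x, f y) \<in> r"
    by (auto simp: digraph_iso_def dest: bij_betwE)
  have inj: "inj_on f (insert z F)" using bij by (rule bij_betw_imp_inj_on)
  have "digraph_iso f F (Restr r F) (f ` F) (Restr r (f ` F))"
    using fe sF inj by (auto simp: digraph_iso_def bij_betw_def intro: inj_on_subset)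
  then obtain g where g: "g \<in> digraph_aut r" "\<forall>x\<in>F. g x = f x"
    using gen F unfolding generic_I_free_def homogeneous_digraph_def by blast
  have bg: "bij g" and ge: "\<And>x y. (x, y) \<in> r \<longleftrightarrow> (g x, g y) \<in> r"
    using g(1) by (auto simp: digraph_aut_def digraph_iso_def)
  define x where "x = inv g (f z)"
  have gx: "g x = f z" using bg by (simp add: x_def bij_is_surj surj_f_inv_f)
  have "x \<notin> F"
  proof
    assume "x \<in> F"
    then have "f x = f z" using g(2) gx by simp
    then show False using inj_onD[OF inj, of x z] \<open>x \<in> F\<close> z by blast
  qed
  moreover have "((x, y) \<in> r \<longleftrightarrow> c y = 0) \<and> ((y, x) \<in> r \<longleftrightarrow> c y = 1)" if "y \<in> F" for y
    using ge[of x y] ge[of y x] gx g(2) that fe[of z y] fe[of y z] z by (auto simp: s_def)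
  ultimately show "\<exists>x\<in>UNIV - F. \<forall>y\<in>F. ((x, y) \<in> r \<longleftrightarrow> c y = 0) \<and> ((y, x) \<in> r \<longleftrightarrow> c y = 1)"
    by blast
qed

section \<open>A generic extension of a tournament\<close>

text \<open>\<open>Ext m x c u\<close> is a vertex adjoined with the same relations to earlier vertices as those listed
  in \<open>u\<close>, except that its relation to \<open>x\<close> is given by the code \<open>c\<close>: an edge to \<open>x\<close> for 0, an edge
  from \<open>x\<close> for 1, no edge otherwise.  The integer \<open>m\<close> provides infinitely many copies, on which an
  automorphism can act by translation.\<close>

datatype 'a vert = Base 'a | Ext int "'a vert" nat "'a vert"

instance vert :: (countable) countable
  by countable_datatype

primrec rank :: "'a vert \<Rightarrow> nat" where
  "rank (Base a) = 0"
| "rank (Ext m x c u) = Suc (max (rank x) (rank u))"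

text \<open>The default 0 gives a vertex edges to all vertices of lower rank that it does not list;
  hence it has only finitely many non-neighbors of lower rank.\<close>

primrec lookup :: "'a vert \<Rightarrow> 'a vert \<Rightarrow> nat" where
  "lookup (Base a) y = 0"
| "lookup (Ext m x c u) y = (if y = x then c else lookup u y)"

definition tournament :: "('a \<Rightarrow> 'a \<Rightarrow> bool) \<Rightarrow> bool" where
  "tournament T \<longleftrightarrow> (\<forall>x y. T x y \<longrightarrow> \<not> T y x) \<and> (\<forall>x y. x \<noteq> y \<longrightarrow> T x y \<or> T y x)"

text \<open>The index is compared first, so raising it moves a vertex forward in the tournament. The
  recursion may compare components of different ranks, whence the mixed clauses.\<close>

fun tie :: "('a \<Rightarrow> 'a \<Rightarrow> bool) \<Rightarrow> 'a vert \<Rightarrow> 'a vert \<Rightarrow> bool" where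
  "tie T (Base a) (Base b) = T a b"
| "tie T (Base a) (Ext m x c u) = True"
| "tie T (Ext m x c u) (Base b) = False"
| "tie T (Ext m x c u) (Ext m' x' c' u') =
     (if m \<noteq> m' then m < m' else if u \<noteq> u' then tie T u u' else if x \<noteq> x' then tie T x x' else c < c')"

definition edges :: "('a \<Rightarrow> 'a \<Rightarrow> bool) \<Rightarrow> 'a vert rel" where
  "edges T = {(x, y). rank x = rank y \<and> tie T x y \<or> rank y < rank x \<and> lookup x y = 0 \<or>
     rank x < rank y \<and> lookup y x = 1}"

text \<open>\<open>A\<close> ranges over all terms, not only over admissible ones, which keeps the
  definition free of recursion.\<close>

definition verts :: "nat \<Rightarrow> ('a \<Rightarrow> 'a \<Rightarrow> bool) \<Rightarrow> 'a vert set" where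
  "verts n T = {x. \<not> (\<exists>A\<subseteq>{y. rank y < rank x \<and> lookup x y \<ge> 2}.
     finite A \<and> card A = n - 1 \<and> independent_set (edges T) A)}"

text \<open>Indices are shifted at all depths, so that references to earlier vertices follow their
  targets.\<close>

primrec lift :: "('a \<Rightarrow> 'b) \<Rightarrow> int \<Rightarrow> 'a vert \<Rightarrow> 'b vert" where
  "lift g d (Base a) = Base (g a)"
| "lift g d (Ext m x c u) = Ext (m + d) (lift g d x) c (lift g d u)"

lemma tie_tournament:
  assumes "tournament T"
  shows "tournament (tie T)"
proof -
  have "\<not> tie T y x" if "tie T x y" for x y
    using assms that
  proof (induction T x y rule: tie.induct)
    case (1 T a b)
    then show ?case by (simp add: tournament_def)
  next
    case (4 T m x c u m' x' c' u')
    then show ?case by (simp split: if_splits)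
  qed simp_all
  moreover have "tie T x y \<or> tie T y x" if "x \<noteq> y" for x y
    using assms that
  proof (induction T x y rule: tie.induct)
    case (1 T a b)
    then show ?case by (simp add: tournament_def)
  next
    case (4 T m x c u m' x' c' u')
    then show ?case by (cases "m = m'"; cases "u = u'"; cases "x = x'") auto
  qed simp_all
  ultimately show ?thesis unfolding tournament_def by blast
qed

lemma edges_oriented:
  assumes "tournament T"
  shows "oriented (edges T)"
proof -
  have "\<not> tie T y x" if "tie T x y" for x y
    using that tie_tournament[OF assms] unfolding tournament_def by blast
  then show ?thesis by (auto simp: oriented_def edges_def)
qed

lemma edges_same_rank:
  "tournament T \<Longrightarrow> rank x = rank y \<Longrightarrow> x \<noteq> y \<Longrightarrow> (x, y) \<in> edges T \<or> (y, x) \<in> edges T"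
  using tie_tournament[of T] unfolding edges_def tournament_def by auto

lemma edges_Base: "(Base a, Base b) \<in> edges T \<longleftrightarrow> T a b"
  by (simp add: edges_def)

lemma Base_in_verts: "n \<ge> 2 \<Longrightarrow> Base a \<in> verts n T"
  by (auto simp: verts_def)

lemma lift_lift: "lift g d (lift g' d' x) = lift (g \<circ> g') (d + d') x"
  by (induction x) auto

lemma lift_id: "lift id 0 x = x"
  by (induction x) auto

lemma rank_lift [simp]: "rank (lift g d x) = rank x"
  by (induction x) auto

lemma inj_lift:
  assumes "inj g"
  shows "lift g d x = lift g d y \<longleftrightarrow> x = y"
proof
  show "lift g d x = lift g d y \<Longrightarrow> x = y"
  proof (induction x arbitrary: y)
    case (Base a y)
    then show ?case using assms by (cases y) (auto dest: injD)
  next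
    case (Ext m x c u y)
    then show ?case by (cases y) auto
  qed
qed simp

lemma lookup_lift: "inj g \<Longrightarrow> lookup (lift g d x) (lift g d y) = lookup x y"
  by (induction x) (auto simp: inj_lift)

definition preserves :: "('a \<Rightarrow> 'a) \<Rightarrow> ('a \<Rightarrow> 'a \<Rightarrow> bool) \<Rightarrow> bool" where
  "preserves g T \<longleftrightarrow> (\<forall>a b. T (g a) (g b) \<longleftrightarrow> T a b)"

lemma tie_lift:
  assumes "inj g" "preserves g T"
  shows "tie T (lift g d x) (lift g d y) \<longleftrightarrow> tie T x y"
  using assms(2)
  by (induction T x y rule: tie.induct)
    (simp_all add: inj_lift[OF assms(1)] preserves_def cong: if_cong)

lemma edges_lift:
  assumes "inj g" "preserves g T"
  shows "(lift g d x, lift g d y) \<in> edges T \<longleftrightarrow> (x, y) \<in> edges T"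
  by (simp add: edges_def tie_lift[OF assms] lookup_lift[OF assms(1)])

lemma lift_inv:
  assumes "bij g"
  shows "lift (inv g) (- d) (lift g d x) = x" "lift g d (lift (inv g) (- d) x) = x"
proof -
  have "inv g \<circ> g = id" "g \<circ> inv g = id"
    using inv_o_cancel[OF bij_is_inj[OF assms]] bij_is_surj[OF assms] surj_iff by blast+
  then show "lift (inv g) (- d) (lift g d x) = x" "lift g d (lift (inv g) (- d) x) = x"
    by (simp_all add: lift_lift lift_id)
qed

text \<open>A forbidden independent set below the image pulls back along the inverse lift to one
  below \<open>x\<close>.\<close>

lemma verts_lift_imp:
  assumes g: "bij g" "preserves g T" and x: "x \<in> verts n T"
  shows "lift g d x \<in> verts n T"
  unfolding verts_def
proof (intro CollectI notI, elim exE conjE)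
  let ?f = "lift g d" and ?h = "lift (inv g) (- d)"
  fix A
  assume A: "A \<subseteq> {y. rank y < rank (?f x) \<and> lookup (?f x) y \<ge> 2}" "finite A" "card A = n - 1"
    "independent_set (edges T) A"
  have fh: "?f (?h y) = y" for y by (rule lift_inv(2)[OF g(1)])
  have inj: "inj g" using g(1) by (rule bij_is_inj)
  have "inj_on ?h A" by (rule inj_on_inverseI[of _ ?f]) (rule fh)
  then have "card (?h ` A) = n - 1" using A(3) by (simp add: card_image)
  moreover have "independent_set (edges T) (?h ` A)"
    unfolding independent_set_def
  proof (intro ballI, elim imageE)
    fix x y a b assume "x = ?h a" "a \<in> A" "y = ?h b" "b \<in> A"
    then show "(x, y) \<notin> edges T"
      using A(4) edges_lift[OF inj g(2), of d x y] fh by (simp add: independent_set_def)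
  qed
  moreover have "rank y < rank x \<and> lookup x y \<ge> 2" if "y \<in> ?h ` A" for y
  proof -
    have "?f y \<in> A" using that fh by auto
    then show ?thesis using A(1) lookup_lift[OF inj, of d x y] by auto
  qed
  ultimately show False using x A(2) unfolding verts_def by blast
qed

lemma verts_lift:
  assumes g: "bij g" "preserves g T"
  shows "bij_betw (lift g d) (verts n T) (verts n T)"
proof (rule bij_betw_byWitness[where f' = "lift (inv g) (- d)"])
  have inv: "preserves (inv g) T"
    using g(2) unfolding preserves_def by (metis bij_inv_eq_iff g(1))
  show "lift g d ` verts n T \<subseteq> verts n T" using verts_lift_imp[OF g] by blast
  show "lift (inv g) (- d) ` verts n T \<subseteq> verts n T"
    using verts_lift_imp[OF bij_imp_bij_inv[OF g(1)] inv] by blast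
qed (simp_all add: lift_inv[OF g(1)])

text \<open>Take \<open>x\<close> of maximal rank in an independent set. Vertices of equal rank are
  joined, so all others have lower rank and are listed by \<open>x\<close> as non-neighbors, which
  membership of \<open>x\<close> in \<open>verts\<close> excludes.\<close>

lemma verts_I_free:
  assumes T: "tournament T" and n: "n \<ge> 2"
  shows "I_free n (verts n T) (edges T)"
  unfolding I_free_def
proof (intro notI, elim exE conjE)
  fix A assume A: "A \<subseteq> verts n T" "finite A" "card A = n" "independent_set (edges T) A"
  have "A \<noteq> {}" using A(3) n by auto
  then have "Max (rank ` A) \<in> rank ` A" using A(2) by (intro Max_in) auto
  then obtain x where "x \<in> A" "rank x = Max (rank ` A)" by auto
  then have x: "x \<in> A" "\<And>y. y \<in> A \<Longrightarrow> rank y \<le> rank x" using A(2) by auto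
  have none: "(y, z) \<notin> edges T" if "y \<in> A" "z \<in> A" for y z
    using A(4) that by (auto simp: independent_set_def)
  have "A - {x} \<subseteq> {y. rank y < rank x \<and> lookup x y \<ge> 2}"
  proof
    fix y assume y: "y \<in> A - {x}"
    then have e: "(x, y) \<notin> edges T" "(y, x) \<notin> edges T" using none x(1) by auto
    then have r: "rank y < rank x" using edges_same_rank[OF T, of x y] y x(2)[of y] by force
    then have "lookup x y \<noteq> 0" "lookup x y \<noteq> 1" using e by (auto simp: edges_def)
    then show "y \<in> {y. rank y < rank x \<and> lookup x y \<ge> 2}" using r by auto
  qed
  moreover have "card (A - {x}) = n - 1" "finite (A - {x})" using A x(1) by auto
  moreover have "independent_set (edges T) (A - {x})" using A(4) by (auto simp: independent_set_def)
  ultimately show False using x(1) A(1) unfolding verts_def by blast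
qed

lemma lookup_ex:
  fixes F :: "'a vert set"
  assumes "finite F"
  shows "\<exists>u. (\<forall>y\<in>F. lookup u y = c y \<and> rank y < rank u) \<and> (\<forall>y. y \<notin> F \<longrightarrow> lookup u y = 0)"
  using assms
proof (induction F rule: finite_induct)
  case empty
  show ?case by (intro exI[of _ "Base undefined"]) simp
next
  case (insert x F)
  then obtain u where u: "\<forall>y\<in>F. lookup u y = c y \<and> rank y < rank u"
    "\<forall>y. y \<notin> F \<longrightarrow> lookup u y = 0" by blast
  then show ?case by (intro exI[of _ "Ext 0 x (c x) u"]) (auto simp: less_Suc_eq_le max_def)
qed

text \<open>The term listing exactly the prescribed type realizes it. Its non-neighbors of lower
  rank all lie in \<open>F\<close> because unlisted vertices get the code 0, so admissibility of the
  type puts the term into \<open>verts\<close>.\<close>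

lemma verts_extension:
  assumes T: "tournament T" and n: "n \<ge> 2"
  shows "extension_property n (verts n T) (edges T)"
  unfolding extension_property_def
proof (intro allI impI, elim conjE)
  fix F :: "'a vert set" and c
  assume F: "finite F"
    and c: "\<not> (\<exists>A\<subseteq>{y\<in>F. c y \<ge> (2::nat)}. card A = n - 1 \<and> independent_set (edges T) A)"
  obtain u where u: "\<And>y. y \<in> F \<Longrightarrow> lookup u y = c y \<and> rank y < rank u"
    "\<And>y. y \<notin> F \<Longrightarrow> lookup u y = 0"
    using lookup_ex[OF F, of c] by blast
  have "y \<in> F \<and> c y \<ge> 2" if "lookup u y \<ge> 2" for y
    using that u by (cases "y \<in> F") auto
  then have "{y. rank y < rank u \<and> lookup u y \<ge> 2} \<subseteq> {y\<in>F. c y \<ge> 2}" by blast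
  then have "u \<in> verts n T" using c unfolding verts_def by blast
  moreover have "u \<notin> F" using u(1) by blast
  moreover have "((u, y) \<in> edges T \<longleftrightarrow> c y = 0) \<and> ((y, u) \<in> edges T \<longleftrightarrow> c y = 1)" if "y \<in> F" for y
    using u(1)[OF that] by (auto simp: edges_def)
  ultimately show "\<exists>x\<in>verts n T - F. \<forall>y\<in>F. ((x, y) \<in> edges T \<longleftrightarrow> c y = 0) \<and> ((y, x) \<in> edges T \<longleftrightarrow> c y = 1)"
    by blast
qed

lemma generic_verts_iso:
  fixes T :: "'a::countable \<Rightarrow> 'a \<Rightarrow> bool"
  assumes "tournament T" "generic_I_free n r" "n \<ge> 2"
  shows "\<exists>h. bij_betw h (verts n T) UNIV \<and>
    (\<forall>x\<in>verts n T. \<forall>y\<in>verts n T. (x, y) \<in> edges T \<longleftrightarrow> (h x, h y) \<in> r)"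
proof (rule extension_property_unique[of n "verts n T" "edges T" UNIV r])
  show "oriented r" using assms(2) digraph_oriented by (auto simp: generic_I_free_def)
  show "verts n T \<noteq> {}" using Base_in_verts[OF assms(3), of undefined T] by auto
  show ?thesis if "bij_betw h (verts n T) UNIV"
    "\<And>x y. x \<in> verts n T \<Longrightarrow> y \<in> verts n T \<Longrightarrow> (x, y) \<in> edges T \<longleftrightarrow> (h x, h y) \<in> r" for h
    using that by blast
qed (use assms in \<open>auto simp: edges_oriented verts_I_free verts_extension
      generic_I_free_I_free generic_I_free_extension\<close>)

section \<open>Coding structures by automorphisms\<close>

type_synonym model = "nat \<Rightarrow> nat list \<Rightarrow> bool"

fun lex_less :: "rat list \<Rightarrow> rat list \<Rightarrow> bool" where
  "lex_less (x # xs) (y # ys) = (x < y \<or> x = y \<and> lex_less xs ys)"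
| "lex_less _ _ = False"

text \<open>An edge runs from a shorter node to a longer one precisely when the shorter is an
  initial segment, so edges and lengths together determine the tree.\<close>

fun node_less :: "rat list \<Rightarrow> rat list \<Rightarrow> bool" where
  "node_less s t =
     (if length s < length t then take (length s) t = s
      else if length t < length s then take (length t) s \<noteq> t
      else lex_less s t)"

text \<open>Over each node \<open>s\<close> there is a copy of the integers, oriented backwards except for pairs at
  distance \<open>length s + 1\<close>.  Translating it by 1 or by -1 codes one bit at \<open>s\<close>, and the exceptional
  distance makes the length of \<open>s\<close> visible in either case.\<close>

fun base_less :: "rat list \<times> int \<Rightarrow> rat list \<times> int \<Rightarrow> bool" where
  "base_less (s, z) (t, w) =
     (if s = t then z < w \<and> w - z = int (length s) + 1 \<or> w < z \<and> z - w \<noteq> int (length s) + 1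
      else node_less s t)"

text \<open>The symbol 0 stands for equality, so that the codes of the types of tuples determine which
  entries coincide.\<close>

definition atom :: "model \<Rightarrow> nat \<Rightarrow> nat list \<Rightarrow> bool" where
  "atom M i xs = (case i of 0 \<Rightarrow> distinct xs | Suc i \<Rightarrow> M i xs)"

text \<open>The bit at a node \<open>s\<close> of length \<open>k\<close> is one atomic fact about the tuple of colors of \<open>s\<close>; which
  one is determined by the first component of \<open>k\<close> under the pairing function, so that each one
  occurs at unboundedly many lengths.\<close>

definition label :: "model \<Rightarrow> rat list \<Rightarrow> bool" where
  "label M s = (case from_nat (fst (prod_decode (length s))) of (i, J) \<Rightarrow>
     set J \<subseteq> {..<length s} \<and> atom M i (map (\<lambda>j. color (s ! j)) J))"

definition rot :: "model \<Rightarrow> rat list \<times> int \<Rightarrow> rat list \<times> int" where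
  "rot M = (\<lambda>(s, z). (s, z + (if label M s then 1 else -1)))"

definition code :: "model \<Rightarrow> (rat list \<times> int) vert \<Rightarrow> (rat list \<times> int) vert" where
  "code M = lift (rot M) 1"

section \<open>The fixed tournament and the automorphisms coding structures\<close>

lemma lex_less_asym: "lex_less s t \<Longrightarrow> \<not> lex_less t s"
  by (induction s t rule: lex_less.induct) auto

lemma lex_less_total: "length s = length t \<Longrightarrow> s \<noteq> t \<Longrightarrow> lex_less s t \<or> lex_less t s"
  by (induction s t rule: list_induct2) auto

lemma lex_less_map:
  "(\<And>x y. x < y \<longleftrightarrow> \<alpha> x < \<alpha> y) \<Longrightarrow> inj \<alpha> \<Longrightarrow> lex_less (map \<alpha> s) (map \<alpha> t) \<longleftrightarrow> lex_less s t"
  by (induction s t rule: lex_less.induct) (auto simp: inj_eq)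

lemma node_less_map:
  assumes "\<And>x y. x < y \<longleftrightarrow> \<alpha> x < \<alpha> y" "inj \<alpha>"
  shows "node_less (map \<alpha> s) (map \<alpha> t) \<longleftrightarrow> node_less s t"
  using lex_less_map[OF assms] by (simp add: take_map inj_map_eq_map[OF assms(2)])

lemma base_less_tournament: "tournament base_less"
proof -
  have asym: "\<not> node_less t s" if "node_less s t" for s t
    using that lex_less_asym[of s t] by (auto split: if_splits)
  have total: "node_less s t \<or> node_less t s" if "s \<noteq> t" for s t
    using that lex_less_total[of s t] by auto
  have "\<not> base_less q p" if "base_less p q" for p q
    using that asym by (cases p; cases q) (auto split: if_splits simp del: node_less.simps)
  moreover have "base_less p q \<or> base_less q p" if "p \<noteq> q" for p q
  proof (cases "fst p = fst q")
    case True
    then have "snd p < snd q \<or> snd q < snd p" using that by (metis linorder_neqE prod_eqI)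
    then show ?thesis using True by (cases p; cases q) (auto simp del: node_less.simps)
  next
    case False
    then show ?thesis using total by (cases p; cases q) (auto simp del: node_less.simps)
  qed
  ultimately show ?thesis unfolding tournament_def by blast
qed

lemma bij_rot: "bij (rot M)"
  by (rule bij_betw_byWitness[where f' = "\<lambda>(s, z). (s, z - (if label M s then 1 else -1))"])
    (auto simp: rot_def)

text \<open>Inside a fiber only differences matter, and between fibers only the nodes do;
  \<open>rot M\<close> translates each fiber by a constant.\<close>

lemma preserves_rot: "preserves (rot M) base_less"
  by (auto simp: preserves_def rot_def simp del: node_less.simps)

lemma code_edges: "(code M x, code M y) \<in> edges base_less \<longleftrightarrow> (x, y) \<in> edges base_less"
  unfolding code_def by (rule edges_lift[OF bij_is_inj[OF bij_rot] preserves_rot])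

lemma code_verts: "bij_betw (code M) (verts n base_less) (verts n base_less)"
  unfolding code_def by (rule verts_lift[OF bij_rot preserves_rot])

text \<open>The label of a node tests fixed positions, chosen by its length; only the colors there
  change, by \<pi>. Injectivity takes care of the symbol for equality.\<close>

lemma label_map:
  assumes \<alpha>: "\<And>x. color (\<alpha> x) = \<pi> (color x)" and \<pi>: "inj \<pi>"
    and iso: "\<And>i xs. M i xs \<longleftrightarrow> N i (map \<pi> xs)"
  shows "label N (map \<alpha> s) \<longleftrightarrow> label M s"
proof -
  have atom: "atom N i (map \<pi> xs) \<longleftrightarrow> atom M i xs" for i xs
    using iso \<pi> by (auto simp: atom_def distinct_map inj_on_subset split: nat.split)
  have "map (\<lambda>j. color (map \<alpha> s ! j)) J = map \<pi> (map (\<lambda>j. color (s ! j)) J)"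
    if "set J \<subseteq> {..<length s}" for J
    using that \<alpha> by auto
  moreover obtain i J where "(from_nat (fst (prod_decode (length s))) :: nat \<times> nat list) = (i, J)"
    by fastforce
  ultimately show ?thesis
    using atom by (cases "set J \<subseteq> {..<length s}") (simp_all only: label_def prod.case length_map simp_thms)
qed

text \<open>An order automorphism \<alpha> that lifts \<pi> acts entrywise on nodes and respects
  labels, so it intertwines the two rotations. Lifting it with shift 0 also commutes with the index
  shift in \<open>code\<close>.\<close>

lemma isomorphic_imp_conjugate:
  assumes "bij \<pi>" "\<And>i xs. M i xs \<longleftrightarrow> N i (map \<pi> xs)"
  shows "\<exists>\<delta>. bij_betw \<delta> (verts n base_less) (verts n base_less) \<and>
    (\<forall>x y. (\<delta> x, \<delta> y) \<in> edges base_less \<longleftrightarrow> (x, y) \<in> edges base_less) \<and>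
    (\<forall>x. \<delta> (code M x) = code N (\<delta> x))"
proof -
  obtain \<alpha> where \<alpha>: "bij \<alpha>" "\<And>x y. x < y \<longleftrightarrow> \<alpha> x < \<alpha> y" "\<And>x. color (\<alpha> x) = \<pi> (color x)"
    using color_lift[OF assms(1)] by blast
  define g :: "rat list \<times> int \<Rightarrow> rat list \<times> int" where "g = map_prod (map \<alpha>) id"
  have inj: "inj \<alpha>" using \<alpha>(1) by (rule bij_is_inj)
  have g: "bij g"
    by (rule bij_betw_byWitness[where f' = "map_prod (map (inv \<alpha>)) id"])
      (use \<alpha>(1) in \<open>auto simp: g_def inv_f_f bij_is_inj bij_is_surj surj_f_inv_f map_idI\<close>)
  have pres: "preserves g base_less"
    using node_less_map[OF \<alpha>(2) inj]
    by (auto simp: preserves_def g_def inj_map_eq_map[OF inj] simp del: node_less.simps)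
  have "g \<circ> rot M = rot N \<circ> g"
    using label_map[of \<alpha> \<pi> M N, OF \<alpha>(3) bij_is_inj[OF assms(1)] assms(2)] by (auto simp: g_def rot_def)
  then have "lift g 0 (code M x) = code N (lift g 0 x)" for x
    by (simp add: code_def lift_lift)
  then show ?thesis
    using verts_lift[OF g pres] edges_lift[OF bij_is_inj[OF g] pres] by (intro exI[of _ "lift g 0"]) simp
qed

section \<open>Decoding: a conjugacy invariant of vertices\<close>

definition back_set :: "('a \<Rightarrow> 'a) \<Rightarrow> 'a rel \<Rightarrow> 'a \<Rightarrow> nat set" where
  "back_set g e x = {j. j > 0 \<and> ((g ^^ j) x, x) \<in> e}"

lemma code_pow_Base:
  "(code M ^^ j) (Base (s, z)) = Base (s, z + (if label M s then int j else - int j))"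
  by (induction j) (auto simp: code_def rot_def)

lemma code_pow_Ext:
  "\<exists>x' u'. (code M ^^ j) (Ext m x c u) = Ext (m + int j) x' c u' \<and> rank x' = rank x \<and> rank u' = rank u"
proof (induction j)
  case (Suc j)
  then obtain x' u' where "(code M ^^ j) (Ext m x c u) = Ext (m + int j) x' c u'"
    "rank x' = rank x" "rank u' = rank u" by blast
  then show ?case by (simp add: code_def)
qed simp

text \<open>The iterates run through the fiber upwards or downwards. Edges in a fiber point
  downwards except at distance \<open>Suc (length s)\<close>, so the set is cofinite for a true
  label and a singleton for a false one, and shows the length in both cases.\<close>

lemma back_set_Base:
  "back_set (code M) (edges base_less) (Base (s, z)) =
     (if label M s then {j. j > 0 \<and> j \<noteq> Suc (length s)} else {Suc (length s)})"
  by (auto simp: back_set_def code_pow_Base edges_Base simp del: node_less.simps)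

text \<open>All iterates have the rank of the vertex itself but a larger index, so the edges lead
  from the vertex to its iterates.\<close>

lemma back_set_Ext: "back_set (code M) (edges base_less) (Ext m x c u) = {}"
proof -
  have "((code M ^^ j) (Ext m x c u), Ext m x c u) \<notin> edges base_less" if "j > 0" for j
  proof -
    obtain x' u' where "(code M ^^ j) (Ext m x c u) = Ext (m + int j) x' c u'"
      "rank x' = rank x" "rank u' = rank u" using code_pow_Ext by blast
    then show ?thesis using that by (simp add: edges_def)
  qed
  then show ?thesis by (auto simp: back_set_def)
qed

lemma back_set_Base_eqD:
  assumes eq: "back_set (code M) (edges base_less) (Base (s, z)) =
    back_set (code N) (edges base_less) y"
  obtains t w where "y = Base (t, w)" "length t = length s" "label N t \<longleftrightarrow> label M s"
proof (cases y)
  case (Base a)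
  obtain t w where a: "a = (t, w)" by fastforce
  let ?k = "length s" and ?l = "length t"
  have mem: "(if label M s then j > 0 \<and> j \<noteq> Suc ?k else j = Suc ?k) \<longleftrightarrow>
      (if label N t then j > 0 \<and> j \<noteq> Suc ?l else j = Suc ?l)" for j
    using eq[THEN eqset_imp_iff, of j] unfolding Base a back_set_Base by (simp split: if_splits)
  \<comment> \<open>The number \<open>?k + ?l + 2\<close> differs from both exceptional distances,
    so its membership gives the label; then \<open>Suc ?k\<close> gives the length.\<close>
  have "?l = ?k \<and> (label N t \<longleftrightarrow> label M s)"
    using mem[of "Suc ?k"] mem[of "?k + ?l + 2"] by (simp split: if_splits)
  then show thesis using that[of t w] Base a by blast
next
  case (Ext m x c u)
  then have "back_set (code M) (edges base_less) (Base (s, z)) = {}"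
    using eq by (simp add: back_set_Ext)
  \<comment> \<open>This witness shows that the set of a base vertex is nonempty also when the label
    is true.\<close>
  moreover have "Suc (Suc k) \<in> {j. j > 0 \<and> j \<noteq> Suc k}" for k by simp
  ultimately show thesis unfolding back_set_Base by (metis empty_iff insert_not_empty)
qed

text \<open>All conditions are restricted to \<open>verts\<close>, since \<delta> will arise by
  transport from the digraph on the natural numbers.\<close>

definition conjugates ::
  "nat \<Rightarrow> model \<Rightarrow> model \<Rightarrow> ((rat list \<times> int) vert \<Rightarrow> (rat list \<times> int) vert) \<Rightarrow> bool" where
  "conjugates n M N \<delta> \<longleftrightarrow> bij_betw \<delta> (verts n base_less) (verts n base_less) \<and>
     (\<forall>x\<in>verts n base_less. \<forall>y\<in>verts n base_less.
        (\<delta> x, \<delta> y) \<in> edges base_less \<longleftrightarrow> (x, y) \<in> edges base_less) \<and>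
     (\<forall>x\<in>verts n base_less. \<delta> (code M x) = code N (\<delta> x))"

lemma conjugates_inv:
  assumes "conjugates n M N \<delta>"
  shows "conjugates n N M (inv_into (verts n base_less) \<delta>)"
proof -
  let ?V = "verts n base_less" and ?E = "edges base_less" and ?i = "inv_into (verts n base_less) \<delta>"
  have b: "bij_betw \<delta> ?V ?V"
    and e: "\<And>x y. x \<in> ?V \<Longrightarrow> y \<in> ?V \<Longrightarrow> (\<delta> x, \<delta> y) \<in> ?E \<longleftrightarrow> (x, y) \<in> ?E"
    and c: "\<And>x. x \<in> ?V \<Longrightarrow> \<delta> (code M x) = code N (\<delta> x)"
    using assms unfolding conjugates_def by blast+
  have bi: "bij_betw ?i ?V ?V" by (rule bij_betw_inv_into[OF b])
  have di: "\<delta> (?i x) = x" "?i x \<in> ?V" if "x \<in> ?V" for x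
    using that bij_betw_inv_into_right[OF b] bij_betwE[OF bi] by auto
  have "?i (code N x) = code M (?i x)" if "x \<in> ?V" for x
  proof -
    have "\<delta> (code M (?i x)) = code N x" using c[OF di(2)[OF that]] di(1)[OF that] by simp
    moreover have "code M (?i x) \<in> ?V" using bij_betwE[OF code_verts] di(2)[OF that] by blast
    ultimately show ?thesis using bij_betw_inv_into_left[OF b] by metis
  qed
  moreover have "(?i x, ?i y) \<in> ?E \<longleftrightarrow> (x, y) \<in> ?E" if "x \<in> ?V" "y \<in> ?V" for x y
    using e[OF di(2)[OF that(1)] di(2)[OF that(2)]] di(1) that by simp
  ultimately show ?thesis using bi unfolding conjugates_def by blast
qed

text \<open>\<open>back_set\<close> is defined from edges and iterates, hence is preserved by
  \<delta>; its values separate base vertices from the others and reveal length and label.\<close>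

lemma conjugates_Base:
  assumes \<delta>: "conjugates n M N \<delta>" and n: "n \<ge> 2"
  obtains t w where "\<delta> (Base (s, z)) = Base (t, w)" "length t = length s" "label N t \<longleftrightarrow> label M s"
proof -
  let ?V = "verts n base_less" and ?E = "edges base_less"
  have b: "bij_betw \<delta> ?V ?V"
    and e: "\<And>x y. x \<in> ?V \<Longrightarrow> y \<in> ?V \<Longrightarrow> (\<delta> x, \<delta> y) \<in> ?E \<longleftrightarrow> (x, y) \<in> ?E"
    and c: "\<And>x. x \<in> ?V \<Longrightarrow> \<delta> (code M x) = code N (\<delta> x)"
    using \<delta> unfolding conjugates_def by blast+
  have pow: "(code M ^^ j) (Base (s, z)) \<in> ?V \<and>
      \<delta> ((code M ^^ j) (Base (s, z))) = (code N ^^ j) (\<delta> (Base (s, z)))" for j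
  proof (induction j)
    case (Suc j)
    then show ?case using bij_betwE[OF code_verts[of M n]] c by simp
  qed (simp add: Base_in_verts[OF n])
  have "((code N ^^ j) (\<delta> (Base (s, z))), \<delta> (Base (s, z))) \<in> ?E \<longleftrightarrow>
      ((code M ^^ j) (Base (s, z)), Base (s, z)) \<in> ?E" for j
    using e[OF pow[of j, THEN conjunct1] Base_in_verts[OF n]] pow[of j] by simp
  then have "back_set (code M) ?E (Base (s, z)) = back_set (code N) ?E (\<delta> (Base (s, z)))"
    by (simp add: back_set_def)
  then show thesis using that by (rule back_set_Base_eqD)
qed

text \<open>There is an edge from \<open>s\<close> to its proper extension \<open>s @ u\<close>. Its
  image is an edge from a shorter node to a longer one, as lengths are preserved, so the image of
  \<open>s\<close> is an initial segment of the image of \<open>s @ u\<close>.\<close>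

lemma conjugates_extend:
  assumes \<delta>: "conjugates n M N \<delta>" and n: "n \<ge> 2"
    and st: "\<delta> (Base (s, z)) = Base (t, w)" and u: "u \<noteq> []"
  obtains v w' where "\<delta> (Base (s @ u, 0)) = Base (t @ v, w')" "length v = length u"
    "label N (t @ v) \<longleftrightarrow> label M (s @ u)"
proof -
  obtain t' w' where t': "\<delta> (Base (s @ u, 0)) = Base (t', w')" "length t' = length (s @ u)"
    "label N t' \<longleftrightarrow> label M (s @ u)"
    by (rule conjugates_Base[OF \<delta> n])
  have len: "length t = length s"
    by (rule conjugates_Base[OF \<delta> n, of s z]) (simp add: st)
  have "(\<delta> (Base (s, z)), \<delta> (Base (s @ u, 0))) \<in> edges base_less \<longleftrightarrow>
      (Base (s, z), Base (s @ u, 0)) \<in> edges base_less"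
    using \<delta>[unfolded conjugates_def, THEN conjunct2, THEN conjunct1] Base_in_verts[OF n] by fast
  moreover have "base_less (s, z) (s @ u, 0)" using u by simp
  ultimately have "base_less (t, w) (t', w')" unfolding edges_Base st t'(1) by blast
  moreover have lt: "length t < length t'" using t'(2) len u by simp
  moreover from lt have "t \<noteq> t'" by blast
  ultimately have "node_less t t'" unfolding base_less.simps by (simp only: if_False)
  then have "take (length t) t' = t" using lt by simp
  then have "t' = t @ drop (length t) t'" by (metis append_take_drop_id)
  then show thesis using that[of "drop (length t) t'" w'] t' len by simp
qed

text \<open>Pad \<open>s\<close> to a length at which the label tests the atom
  \<open>(i, J)\<close>. The padding leaves the entries at positions in \<open>J\<close> unchanged,
  and \<delta> preserves the label of the padded node.\<close>

lemma conjugates_atom: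
  assumes \<delta>: "conjugates n M N \<delta>" and n: "n \<ge> 2"
    and st: "\<delta> (Base (s, z)) = Base (t, w)" and J: "set J \<subseteq> {..<length s}"
  shows "atom N i (map (\<lambda>j. color (t ! j)) J) \<longleftrightarrow> atom M i (map (\<lambda>j. color (s ! j)) J)"
proof -
  \<comment> \<open>A pairing code is at least its second component; the successor makes
    \<open>k\<close> exceed \<open>length s\<close>, so that the padding is nonempty.\<close>
  define k where "k = prod_encode (to_nat (i, J), Suc (length s))"
  have k: "length s < k" using le_prod_encode_2[of "Suc (length s)"] by (simp add: k_def Suc_le_eq)
  define u :: "rat list" where "u = replicate (k - length s) 0"
  have u: "u \<noteq> []" "length (s @ u) = k" using k by (simp_all add: u_def)
  obtain v w' where v: "length v = length u" "label N (t @ v) \<longleftrightarrow> label M (s @ u)"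
    by (rule conjugates_extend[OF \<delta> n st u(1)])
  have len: "length t = length s"
    by (rule conjugates_Base[OF \<delta> n, of s z]) (simp add: st)
  have label: "label K x \<longleftrightarrow> set J \<subseteq> {..<k} \<and> atom K i (map (\<lambda>j. color (x ! j)) J)"
    if "length x = k" for K x
    using that by (simp add: label_def k_def)
  have prefix: "map (\<lambda>j. color ((x @ y) ! j)) J = map (\<lambda>j. color (x ! j)) J" if "length x = length s" for x y
    using J that by (auto simp: nth_append)
  have "set J \<subseteq> {..<k}" using J k by auto
  then show ?thesis
    using label[of "t @ v" N] label[of "s @ u" M] prefix[OF len, of v] prefix[OF refl, of u] v len u(2)
    by (simp del: map_eq_conv)
qed

text \<open>Back and forth with the partial maps that match the colors along a node with those along
  its image. Appending a rational of a given color extends the domain; the inverse of \<delta>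
  extends the range.\<close>

lemma conjugates_imp_isomorphic:
  assumes \<delta>: "conjugates n M N \<delta>" and n: "n \<ge> 2"
  shows "\<exists>\<pi>. bij \<pi> \<and> (\<forall>i xs. M i xs \<longleftrightarrow> N i (map \<pi> xs))"
proof -
  let ?V = "verts n base_less"
  define pairs where "pairs s t = (\<lambda>j. (color (s ! j), color (t ! j))) ` {..<length s}" for s t
  have pairs_snoc: "pairs (s @ [q]) (t @ [q']) = insert (color q, color q') (pairs s t)"
    if "length t = length s" for s t q q'
  proof -
    have "(\<lambda>j. (color ((s @ [q]) ! j), color ((t @ [q']) ! j))) ` {..<length s} = pairs s t"
      unfolding pairs_def using that by (intro image_cong) (auto simp: nth_append)
    then show ?thesis using that by (simp add: pairs_def lessThan_Suc nth_append)
  qed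
  define P where "P p \<longleftrightarrow> (\<exists>s t z w. \<delta> (Base (s, z)) = Base (t, w) \<and> p = pairs s t)" for p
  have len: "length t = length s" if "\<delta> (Base (s, z)) = Base (t, w)" for s t z w
    by (rule conjugates_Base[OF \<delta> n, of s z]) (simp add: that)
  have atom: "atom N i (map (\<lambda>j. color (t ! j)) J) \<longleftrightarrow> atom M i (map (\<lambda>j. color (s ! j)) J)"
    if "\<delta> (Base (s, z)) = Base (t, w)" "set J \<subseteq> {..<length s}" for s t z w i J
    by (rule conjugates_atom[OF \<delta> n that])
  have b: "bij_betw \<delta> ?V ?V" using \<delta> unfolding conjugates_def by blast
  have "\<exists>\<pi>. bij_betw \<pi> UNIV UNIV \<and>
    (\<forall>F\<subseteq>UNIV. finite F \<longrightarrow> (\<exists>p. P p \<and> (\<forall>a\<in>F. (a, \<pi> a) \<in> p)))"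
  proof (rule back_and_forth)
    obtain t w where "\<delta> (Base ([], 0)) = Base (t, w)" by (rule conjugates_Base[OF \<delta> n])
    then show "P {}" unfolding P_def pairs_def by (intro exI[of _ "[]"] exI) auto
  next
    fix p a assume "P p"
    then obtain s t z w where st: "\<delta> (Base (s, z)) = Base (t, w)" and p: "p = pairs s t"
      unfolding P_def by blast
    obtain q where q: "color q = a" using color_surj by blast
    obtain v w' where v: "\<delta> (Base (s @ [q], 0)) = Base (t @ v, w')" "length v = length [q]"
      by (rule conjugates_extend[OF \<delta> n st, of "[q]"]) auto
    then obtain q' where "v = [q']" by (auto simp: length_Suc_conv)
    then show "\<exists>b. P (insert (a, b) p)"
      using v(1) pairs_snoc[OF len[OF st]] q p unfolding P_def by metis
  next
    fix p b assume "P p"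
    then obtain s t z w where st: "\<delta> (Base (s, z)) = Base (t, w)" and p: "p = pairs s t"
      unfolding P_def by blast
    let ?i = "inv_into ?V \<delta>"
    have ts: "?i (Base (t, w)) = Base (s, z)"
      using bij_betw_inv_into_left[OF b] Base_in_verts[OF n] st by metis
    obtain q' where q': "color q' = b" using color_surj by blast
    obtain v z' where v: "?i (Base (t @ [q'], 0)) = Base (s @ v, z')" "length v = length [q']"
      by (rule conjugates_extend[OF conjugates_inv[OF \<delta>] n ts, of "[q']"]) auto
    then obtain q where "v = [q]" by (auto simp: length_Suc_conv)
    moreover from this have "\<delta> (Base (s @ [q], z')) = Base (t @ [q'], 0)"
      using bij_betw_inv_into_right[OF b] Base_in_verts[OF n] v(1) by metis
    ultimately show "\<exists>a. P (insert (a, b) p)"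
      using pairs_snoc[OF len[OF st]] q' p unfolding P_def by metis
  next
    fix p x y x' y' assume "P p" "(x, y) \<in> p" "(x', y') \<in> p"
    then obtain s t z w j j' where "\<delta> (Base (s, z)) = Base (t, w)" "j < length s" "j' < length s"
      and xy: "x = color (s ! j)" "y = color (t ! j)" "x' = color (s ! j')" "y' = color (t ! j')"
      unfolding P_def pairs_def by auto
    \<comment> \<open>The atom 0 of a pair says that its entries differ, so its preservation makes
      the partial map well defined and injective.\<close>
    then have "atom N 0 [y, y'] \<longleftrightarrow> atom M 0 [x, x']" using atom[of s z t w "[j, j']" 0] by simp
    then show "x = x' \<longleftrightarrow> y = y'" by (auto simp: atom_def)
  qed auto
  then obtain \<pi> where \<pi>: "bij \<pi>" "\<And>F. finite F \<Longrightarrow> \<exists>p. P p \<and> (\<forall>a\<in>F. (a, \<pi> a) \<in> p)"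
    by auto
  have "M i xs \<longleftrightarrow> N i (map \<pi> xs)" for i xs
  proof -
    obtain s t z w where st: "\<delta> (Base (s, z)) = Base (t, w)"
      and "\<forall>a\<in>set xs. (a, \<pi> a) \<in> pairs s t"
      using \<pi>(2)[of "set xs"] unfolding P_def by auto
    then have "\<forall>a\<in>set xs. \<exists>j<length s. a = color (s ! j) \<and> \<pi> a = color (t ! j)"
      unfolding pairs_def by auto
    then obtain f where f: "\<And>a. a \<in> set xs \<Longrightarrow> f a < length s \<and> a = color (s ! f a) \<and> \<pi> a = color (t ! f a)"
      by metis
    have J: "set (map f xs) \<subseteq> {..<length s}" using f by auto
    have eqs: "map (\<lambda>j. color (s ! j)) (map f xs) = xs"
      "map (\<lambda>j. color (t ! j)) (map f xs) = map \<pi> xs"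
      using f by (auto intro!: map_idI)
    show ?thesis using atom[OF st J, of "Suc i"] unfolding eqs by (simp add: atom_def)
  qed
  then show ?thesis using \<pi>(1) by blast
qed

section \<open>The reduction\<close>

lemma label_measurable: "Measurable.pred borel (\<lambda>M. label M s)"
proof -
  have coord: "Measurable.pred borel (\<lambda>M :: model. M i xs)" for i xs
  proof -
    have "(\<lambda>M :: model. M i xs) \<in> borel \<rightarrow>\<^sub>M borel"
      using measurable_compose[OF measurable_product_coordinates[of i] measurable_product_coordinates[of xs]] .
    then show ?thesis
      using measurable_cong_sets[OF refl sets_borel_eq_count_space] by blast
  qed
  have "Measurable.pred borel (\<lambda>M. atom M i xs)" for i xs
    using coord by (cases i) (simp_all add: atom_def)
  then show ?thesis by (simp add: label_def split: prod.split)
qed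

text \<open>A base vertex has two possible values, selected by one label. For an adjoined vertex the
  image of \<open>x\<close> takes countably many values, so it can be treated as a parameter while
  the image of \<open>u\<close> varies.\<close>

lemma code_measurable: "(\<lambda>M. code M x) \<in> borel \<rightarrow>\<^sub>M count_space UNIV"
proof (induction x)
  case (Base a)
  obtain s z where a: "a = (s, z)" by fastforce
  have "(\<lambda>M. code M (Base a)) = (\<lambda>M. if label M s then Base (s, z + 1) else Base (s, z - 1))"
    by (auto simp: a code_def rot_def)
  moreover have "\<dots> \<in> borel \<rightarrow>\<^sub>M count_space UNIV"
    by (rule measurable_If) (use label_measurable[of s] in \<open>simp_all add: pred_def\<close>)
  ultimately show ?case by simp
next
  case (Ext m x c u)
  have "(\<lambda>M. (\<lambda>y M. Ext (m + 1) y c (code M u)) (code M x) M) \<in> borel \<rightarrow>\<^sub>M count_space UNIV"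
  proof (rule measurable_compose_countable[OF _ Ext.IH(1)])
    show "(\<lambda>M. Ext (m + 1) y c (code M u)) \<in> borel \<rightarrow>\<^sub>M count_space UNIV" for y
      using measurable_compose[OF Ext.IH(2) measurable_count_space] .
  qed
  then show ?case by (simp add: code_def)
qed

lemma digraph_aut_iff: "g \<in> digraph_aut r \<longleftrightarrow> bij g \<and> (\<forall>x y. (g x, g y) \<in> r \<longleftrightarrow> (x, y) \<in> r)"
  by (auto simp: digraph_aut_def digraph_iso_def)

lemma equiv_conjugacy: "equiv (digraph_aut r) (conjugacy (digraph_aut r))"
proof -
  let ?G = "digraph_aut r"
  have id: "id \<in> ?G" by (simp add: digraph_aut_iff)
  have comp: "g \<circ> h \<in> ?G" if "g \<in> ?G" "h \<in> ?G" for g h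
    using that by (simp add: digraph_aut_iff bij_comp)
  have inv: "inv g \<in> ?G" if "g \<in> ?G" for g
  proof -
    have bg: "bij g" and ge: "(g x, g y) \<in> r \<longleftrightarrow> (x, y) \<in> r" for x y
      using that unfolding digraph_aut_iff by blast+
    have "g (inv g x) = x" for x using bg by (simp add: bij_is_surj surj_f_inv_f)
    then have "(inv g x, inv g y) \<in> r \<longleftrightarrow> (x, y) \<in> r" for x y
      using ge[of "inv g x" "inv g y"] by simp
    then show ?thesis using bij_imp_bij_inv[OF bg] unfolding digraph_aut_iff by blast
  qed
  have bij: "bij g" if "g \<in> ?G" for g using that by (simp add: digraph_aut_iff)
  show ?thesis
  proof (rule equivI)
    show "conjugacy ?G \<subseteq> ?G \<times> ?G" by (auto simp: conjugacy_def)
    show "refl_on ?G (conjugacy ?G)"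
      unfolding refl_on_def conjugacy_def using id by (auto intro: bexI[of _ id])
    show "sym (conjugacy ?G)"
    proof (rule symI)
      fix \<phi> \<psi> assume "(\<phi>, \<psi>) \<in> conjugacy ?G"
      then obtain d where d: "\<phi> \<in> ?G" "\<psi> \<in> ?G" "d \<in> ?G" "\<psi> = d \<circ> \<phi> \<circ> inv d"
        by (auto simp: conjugacy_def)
      have "\<phi> = inv d \<circ> \<psi> \<circ> inv (inv d)"
        unfolding d(4) inv_inv_eq[OF bij[OF d(3)]]
        by (simp add: fun_eq_iff inv_f_f bij_is_inj[OF bij[OF d(3)]])
      then show "(\<psi>, \<phi>) \<in> conjugacy ?G" using d(1,2) inv[OF d(3)] unfolding conjugacy_def by blast
    qed
    show "trans (conjugacy ?G)"
    proof (rule transI)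
      fix \<phi> \<psi> \<theta> assume "(\<phi>, \<psi>) \<in> conjugacy ?G" "(\<psi>, \<theta>) \<in> conjugacy ?G"
      then obtain d e where d: "\<phi> \<in> ?G" "\<theta> \<in> ?G" "d \<in> ?G" "\<psi> = d \<circ> \<phi> \<circ> inv d"
        and e: "e \<in> ?G" "\<theta> = e \<circ> \<psi> \<circ> inv e"
        by (auto simp: conjugacy_def)
      have "\<theta> = (e \<circ> d) \<circ> \<phi> \<circ> inv (e \<circ> d)"
        unfolding d(4) e(2) by (simp add: o_inv_distrib[OF bij[OF e(1)] bij[OF d(3)]] o_assoc)
      then show "(\<phi>, \<theta>) \<in> conjugacy ?G"
        using d(1,2) comp[OF e(1) d(3)] unfolding conjugacy_def by blast
    qed
  qed
qed

theorem theorem4p2: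
  fixes n :: nat and r :: "nat rel"
  assumes "n \<ge> 2"
    and "generic_I_free n r"
  shows "borel_complete (digraph_aut r) (conjugacy (digraph_aut r))"
proof -
  let ?V = "verts n base_less" and ?E = "edges base_less" and ?G = "digraph_aut r"
  obtain h where h: "bij_betw h ?V UNIV"
    and he: "\<And>x y. x \<in> ?V \<Longrightarrow> y \<in> ?V \<Longrightarrow> (x, y) \<in> ?E \<longleftrightarrow> (h x, h y) \<in> r"
    using generic_verts_iso[OF base_less_tournament assms(2,1)] by blast
  define k where "k = inv_into ?V h"
  have k: "bij_betw k UNIV ?V" unfolding k_def by (rule bij_betw_inv_into[OF h])
  have kV: "k i \<in> ?V" for i using bij_betwE[OF k] by blast
  have hk: "h (k i) = i" for i unfolding k_def using bij_betw_inv_into_right[OF h] by blast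
  have kh: "k (h x) = x" if "x \<in> ?V" for x
    unfolding k_def using bij_betw_inv_into_left[OF h that] .
  have transport: "h \<circ> g \<circ> k \<in> ?G"
    if "bij_betw g ?V ?V" and g: "\<And>x y. (g x, g y) \<in> ?E \<longleftrightarrow> (x, y) \<in> ?E" for g
  proof -
    have gV: "g (k i) \<in> ?V" for i using bij_betwE[OF that(1)] kV by blast
    have "bij (h \<circ> g \<circ> k)" by (rule bij_betw_trans[OF k bij_betw_trans[OF that(1) h]])
    moreover have "((h \<circ> g \<circ> k) i, (h \<circ> g \<circ> k) j) \<in> r \<longleftrightarrow> (i, j) \<in> r" for i j
      using he[OF gV gV, of i j] he[OF kV kV, of i j] g hk by simp
    ultimately show ?thesis by (simp add: digraph_aut_iff)
  qed
  have cV: "code M x \<in> ?V" if "x \<in> ?V" for M x using bij_betwE[OF code_verts] that by blast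
  \<comment> \<open>The identification \<open>h\<close> is chosen before \<open>M\<close>, so every
    structure yields an automorphism of the same digraph \<open>r\<close>.\<close>
  define f where "f M = h \<circ> code M \<circ> k" for M
  have fG: "f M \<in> ?G" for M
    unfolding f_def by (rule transport[OF code_verts code_edges])
  \<comment> \<open>For the product topology on functions it suffices to check each value
    \<open>f M i\<close> separately.\<close>
  have f_measurable: "f \<in> borel_measurable borel"
  proof (rule measurable_coordinatewise_then_product)
    show "(\<lambda>M. f M i) \<in> borel_measurable borel" for i
      unfolding f_def comp_def
      using measurable_compose[OF code_measurable borel_measurable_count_space] .
  qed
  have reduction: "(\<exists>\<pi>. bij \<pi> \<and> (\<forall>i xs. M i xs \<longleftrightarrow> N i (map \<pi> xs))) \<longleftrightarrow> (f M, f N) \<in> conjugacy ?G"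
    for M N
  proof
    assume "\<exists>\<pi>. bij \<pi> \<and> (\<forall>i xs. M i xs \<longleftrightarrow> N i (map \<pi> xs))"
    then obtain \<pi> where \<pi>: "bij \<pi>" "\<And>i xs. M i xs \<longleftrightarrow> N i (map \<pi> xs)" by blast
    obtain \<delta> where \<delta>: "bij_betw \<delta> ?V ?V" "\<And>x y. (\<delta> x, \<delta> y) \<in> ?E \<longleftrightarrow> (x, y) \<in> ?E"
      "\<And>x. \<delta> (code M x) = code N (\<delta> x)"
      using isomorphic_imp_conjugate[of \<pi> M N n, OF \<pi>] by (elim exE conjE) simp
    define d where "d = h \<circ> \<delta> \<circ> k"
    have dG: "d \<in> ?G" unfolding d_def by (rule transport[OF \<delta>(1,2)])
    have "d (f M i) = f N (d i)" for i
      using kh cV kV bij_betwE[OF \<delta>(1)] \<delta>(3) by (simp add: d_def f_def)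
    moreover have "d (inv d i) = i" for i
      using dG by (simp add: digraph_aut_iff bij_is_surj surj_f_inv_f)
    ultimately have "f N = d \<circ> f M \<circ> inv d" by (simp add: fun_eq_iff)
    then show "(f M, f N) \<in> conjugacy ?G" using dG fG unfolding conjugacy_def by blast
  next
    assume "(f M, f N) \<in> conjugacy ?G"
    then obtain d where d: "d \<in> ?G" "f N = d \<circ> f M \<circ> inv d" by (auto simp: conjugacy_def)
    then have bd: "bij d" and dr: "\<And>i j. (d i, d j) \<in> r \<longleftrightarrow> (i, j) \<in> r"
      by (auto simp: digraph_aut_iff)
    have df: "f N (d i) = d (f M i)" for i
      using d(2) bd by (simp add: bij_is_inj)
    define \<delta> where "\<delta> = k \<circ> d \<circ> h"
    have "bij_betw \<delta> ?V ?V" unfolding \<delta>_def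
      by (rule bij_betw_trans[OF h bij_betw_trans[OF bd k]])
    moreover have "(\<delta> x, \<delta> y) \<in> ?E \<longleftrightarrow> (x, y) \<in> ?E" if "x \<in> ?V" "y \<in> ?V" for x y
      using he[OF that] he[OF kV kV, of "d (h x)" "d (h y)"] dr by (simp add: \<delta>_def hk)
    moreover have "\<delta> (code M x) = code N (\<delta> x)" if "x \<in> ?V" for x
    proof -
      have "\<delta> (code M x) = k (d (f M (h x)))" using that by (simp add: \<delta>_def f_def kh)
      also have "\<dots> = k (f N (d (h x)))" by (simp add: df)
      also have "\<dots> = code N (\<delta> x)" by (simp add: \<delta>_def f_def kh cV kV)
      finally show ?thesis .
    qed
    ultimately have "conjugates n M N \<delta>" unfolding conjugates_def by blast
    then show "\<exists>\<pi>. bij \<pi> \<and> (\<forall>i xs. M i xs \<longleftrightarrow> N i (map \<pi> xs))"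
      using assms(1) by (rule conjugates_imp_isomorphic)
  qed
  have "borel_reducible K (isomorphism_on S ar K) ?G (conjugacy ?G)" if "K \<subseteq> structures S ar" for S ar K
    unfolding borel_reducible_def
  proof (rule bexI[of _ f], intro ballI)
    fix M N assume MN: "M \<in> K" "N \<in> K"
    have sym: "i \<in> S \<and> length xs = ar i" if "L \<in> K" "L i xs" for L i xs
      using \<open>K \<subseteq> structures S ar\<close> that unfolding structures_def by blast
    \<comment> \<open>Members of \<open>K\<close> are false off the language and on tuples of the
      wrong length, and \<open>map \<pi>\<close> keeps lengths; so the bounded and the unbounded
      condition agree.\<close>
    have "(\<forall>i\<in>S. \<forall>xs. length xs = ar i \<longrightarrow> (M i xs \<longleftrightarrow> N i (map \<pi> xs))) \<longleftrightarrow>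
        (\<forall>i xs. M i xs \<longleftrightarrow> N i (map \<pi> xs))" for \<pi>
      using sym[OF MN(1)] sym[OF MN(2)] by (metis length_map)
    then show "(M, N) \<in> isomorphism_on S ar K \<longleftrightarrow> (f M, f N) \<in> conjugacy ?G"
      using MN by (simp add: isomorphism_on_def reduction[symmetric])
  next
    show "f \<in> restrict_space borel K \<rightarrow>\<^sub>M restrict_space borel ?G"
      using f_measurable fG by (intro measurable_restrict_space1 measurable_restrict_space2) auto
  qed
  then show ?thesis by (simp add: borel_complete_def equiv_conjugacy)
qed

end
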